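(* For any finite non-abelian group $G$, $$\frac{\gamma(\mathcal{C}^{**}(G))}{|G|}\le\frac23,$$ and equality holds if and only if $G$ is isomorphic to the symmetric group $S_3$.
   Context: For a finite group $G$ with center $Z(G)$, the proper commuting graph $\mathcal{C}^{**}(G)$ is the simple graph with vertex set $G\setminus Z(G)$ in which two distinct vertices $x,y$ are adjacent if and only if $xy=yx$. A dominating set of a finite simple graph with vertex set $V$ is a subset $X\subseteq V$ such that every vertex of $V\setminus X$ is adjacent to some vertex of $X$; the domination number $\gamma$ is the minimum cardinality of a dominating set. *)

theory Defs
  imports Complex_Main "HOL-Algebra.Sym_Groups" "Graph_Theory.Pair_Digraph"
begin

definition center :: "('a, 'b) monoid_scheme \<Rightarrow> 'a set" where
  "center G = {z \<in> carrier G. \<forall>x \<in> carrier G. z \<otimes>\<^bsub>G\<^esub> x = x \<otimes>\<^bsub>G\<^esub> z}"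

text \<open>Following \<^theory>\<open>Graph_Theory.Pair_Digraph\<close>, a simple graph is a loop-free symmetric
  digraph: an edge between \<open>x\<close> and \<open>y\<close> is the pair of arcs \<open>(x, y)\<close> and \<open>(y, x)\<close>.\<close>

definition proper_commuting_graph :: "('a, 'b) monoid_scheme \<Rightarrow> 'a pair_pre_digraph" where
  "proper_commuting_graph G =
    \<lparr> pverts = carrier G - center G,
      parcs = {(x, y). x \<in> carrier G - center G \<and> y \<in> carrier G - center G \<and>
                       x \<noteq> y \<and> x \<otimes>\<^bsub>G\<^esub> y = y \<otimes>\<^bsub>G\<^esub> x} \<rparr>"

lemma pair_graph_proper_commuting_graph:
  assumes "finite (carrier G)"
  shows "pair_graph (proper_commuting_graph G)"
proof -
  let ?H = "proper_commuting_graph G"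
  have "parcs ?H \<subseteq> carrier G \<times> carrier G"
    by (auto simp: proper_commuting_graph_def)
  then have "finite (parcs ?H)"
    using assms by (meson finite_SigmaI finite_subset)
  moreover have "finite (pverts ?H)"
    using assms by (simp add: proper_commuting_graph_def)
  moreover have "symmetric ?H"
    by (auto simp: symmetric_def sym_def arcs_ends_conv proper_commuting_graph_def)
  ultimately show ?thesis
    by unfold_locales (auto simp: proper_commuting_graph_def)
qed

definition dominating_set :: "'a pair_pre_digraph \<Rightarrow> 'a set \<Rightarrow> bool" where
  "dominating_set H X \<longleftrightarrow>
    X \<subseteq> pverts H \<and> (\<forall>v \<in> pverts H - X. \<exists>x \<in> X. (v, x) \<in> parcs H)"

text \<open>Only meaningful for finite graphs, since \<^const>\<open>card\<close> vanishes on infinite sets.\<close>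

definition domination_number :: "'a pair_pre_digraph \<Rightarrow> nat" where
  "domination_number H = (LEAST n. \<exists>X. dominating_set H X \<and> card X = n)"

end

theory Submission
  imports Defs
begin

text \<open>
  The bound is decided by the isolated vertices of the graph. If there are none, then the complement
  of a smallest dominating set is again dominating, so at most half of the vertices suffice, and
  the quotient stays below \<open>1/2\<close>, as the identity is not a vertex.

  Suppose that \<open>x\<close> is an isolated vertex. As \<open>x\<close> commutes with \<open>x z\<close> for every central \<open>z\<close> and with
  \<open>x\<^sup>2\<close>, the center is trivial and \<open>x\<close> is an involution whose centralizer is \<open>{1, x}\<close>. Such an
  involution forces \<open>G\<close> to be generalized dihedral: the conjugacy class \<open>K\<close> of \<open>x\<close> has
  \<open>\<bar>G\<bar>/2\<close> elements, and it is disjoint from \<open>k K\<close> for each \<open>k \<in> K\<close>, since two involutions whose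
  product is an involution commute, whereas distinct elements of \<open>K\<close> do not. Hence \<open>k K\<close> is the complement of \<open>K\<close>. So each \<open>k \<in> K\<close>
  inverts every element outside \<open>K\<close>, and the elements outside \<open>K\<close>, being products of two elements
  of \<open>K\<close>, commute with each other. The graph thus consists of the isolated points \<open>K\<close> and one
  clique, so its domination number is exactly \<open>\<bar>G\<bar>/2 + 1\<close>. This is at most \<open>2\<bar>G\<bar>/3\<close> if and only if
  \<open>\<bar>G\<bar> \<ge> 6\<close>, with equality only for \<open>\<bar>G\<bar> = 6\<close>. Now \<open>K\<close> contains, besides \<open>x\<close>, some other \<open>k\<close> and
  then also \<open>x k x\<close>, which gives \<open>\<bar>G\<bar> \<ge> 6\<close>. If \<open>\<bar>G\<bar> = 6\<close>, these are the only elements of \<open>K\<close>, and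
  conjugation on \<open>K\<close> identifies \<open>G\<close> with \<open>S\<^sub>3\<close>. Conversely, a transposition of \<open>S\<^sub>3\<close> is an isolated
  vertex, so that the formula applies to \<open>S\<^sub>3\<close>.
\<close>

section \<open>Domination numbers\<close>

lemma domination_number_le:
  assumes "dominating_set H X"
  shows "domination_number H \<le> card X"
  unfolding domination_number_def by (rule Least_le) (use assms in blast)

lemma domination_number_attained:
  obtains X where "dominating_set H X" "card X = domination_number H"
proof -
  have "dominating_set H (pverts H)"
    by (simp add: dominating_set_def)
  then have "\<exists>n X. dominating_set H X \<and> card X = n"
    by blast
  from LeastI_ex[OF this] show thesis
    using that unfolding domination_number_def by blast
qed

text \<open>
  This is Ore's bound. Each vertex of a smallest dominating set \<open>X\<close> has a neighbour outside
  \<open>X\<close>; otherwise it would have a neighbour inside \<open>X\<close> and could be dropped. So the complement of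
  \<open>X\<close> dominates as well.
\<close>

lemma domination_number_le_half:
  assumes fin: "finite (pverts H)"
    and sym: "\<And>u v. (u, v) \<in> parcs H \<Longrightarrow> (v, u) \<in> parcs H"
    and nbr: "\<And>v. v \<in> pverts H \<Longrightarrow> \<exists>w \<in> pverts H. w \<noteq> v \<and> (v, w) \<in> parcs H"
  shows "2 * domination_number H \<le> card (pverts H)"
proof -
  obtain X where X: "dominating_set H X" and cX: "card X = domination_number H"
    by (rule domination_number_attained)
  have sub: "X \<subseteq> pverts H"
    using X by (simp add: dominating_set_def)
  then have finX: "finite X"
    using fin finite_subset by blast
  have "\<exists>w \<in> pverts H - X. (v, w) \<in> parcs H" if v: "v \<in> X" for v
  proof (rule ccontr)
    assume no: "\<not> ?thesis"
    have "dominating_set H (X - {v})"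
      unfolding dominating_set_def
    proof (intro conjI ballI)
      show "X - {v} \<subseteq> pverts H"
        using sub by blast
    next
      fix u assume u: "u \<in> pverts H - (X - {v})"
      show "\<exists>y \<in> X - {v}. (u, y) \<in> parcs H"
      proof (cases "u = v")
        case True
        then show ?thesis
          using nbr[of v] v sub no by blast
      next
        case False
        then obtain y where "y \<in> X" "(u, y) \<in> parcs H"
          using u X by (auto simp: dominating_set_def)
        moreover from this have "y \<noteq> v"
          using no sym u False by blast
        ultimately show ?thesis
          by blast
      qed
    qed
    then have "card X \<le> card (X - {v})"
      using domination_number_le cX by metis
    then show False
      using v finX by (metis card_Diff1_less not_le)
  qed
  then have "dominating_set H (pverts H - X)"
    by (auto simp: dominating_set_def)
  then have "card X \<le> card (pverts H - X)"
    using domination_number_le cX by metis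
  moreover have "card (pverts H) = card X + card (pverts H - X)"
    using card_Diff_subset[OF finX sub] card_mono[OF fin sub] by simp
  ultimately show ?thesis
    using cX by simp
qed

section \<open>Involutions that generate their own centralizer\<close>

locale self_centralizing_involution = group G for G (structure) +
  fixes x
  assumes finite_carrier: "finite (carrier G)"
    and x_closed [simp]: "x \<in> carrier G"
    and x_not_one: "x \<noteq> \<one>"
    and centralizer_trivial: "\<lbrakk>g \<in> carrier G; g \<otimes> x = x \<otimes> g\<rbrakk> \<Longrightarrow> g = \<one> \<or> g = x"
begin

definition K where "K = (\<lambda>g. g \<otimes> x \<otimes> inv g) ` carrier G"

lemma x_square [simp]: "x \<otimes> x = \<one>"
  using centralizer_trivial[of "x \<otimes> x"] x_not_one by (auto simp: m_assoc)

lemma K_cases: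
  assumes "k \<in> K"
  obtains g where "g \<in> carrier G" "k = g \<otimes> x \<otimes> inv g"
  using assms by (auto simp: K_def)

lemma K_closed [simp]: "k \<in> K \<Longrightarrow> k \<in> carrier G"
  by (auto simp: K_def)

lemma finite_K: "finite K"
  using finite_carrier by (simp add: K_def)

lemma x_in_K: "x \<in> K"
  unfolding K_def by (rule image_eqI[of _ _ \<one>]) auto

lemma cancel_left [simp]:
  "\<lbrakk>a \<in> carrier G; b \<in> carrier G\<rbrakk> \<Longrightarrow> a \<otimes> (inv a \<otimes> b) = b"
  "\<lbrakk>a \<in> carrier G; b \<in> carrier G\<rbrakk> \<Longrightarrow> inv a \<otimes> (a \<otimes> b) = b"
  by (simp_all flip: m_assoc)

lemma K_conj_closed:
  assumes "g \<in> carrier G" "k \<in> K"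
  shows "g \<otimes> k \<otimes> inv g \<in> K"
proof -
  obtain h where h: "h \<in> carrier G" "k = h \<otimes> x \<otimes> inv h"
    using assms K_cases by metis
  then have "g \<otimes> k \<otimes> inv g = (g \<otimes> h) \<otimes> x \<otimes> inv (g \<otimes> h)"
    using assms by (simp add: m_assoc inv_mult_group)
  then show ?thesis
    using assms h unfolding K_def by blast
qed

lemma K_square [simp]:
  assumes "k \<in> K"
  shows "k \<otimes> k = \<one>"
proof -
  obtain h where h: "h \<in> carrier G" "k = h \<otimes> x \<otimes> inv h"
    using assms K_cases by metis
  have "k \<otimes> k = h \<otimes> (x \<otimes> x) \<otimes> inv h"
    using h by (simp add: m_assoc del: x_square)
  then show ?thesis
    using h by simp
qed

lemma K_inv [simp]: "k \<in> K \<Longrightarrow> inv k = k"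
  by (simp add: inv_equality)

lemma K_cancel [simp]: "\<lbrakk>k \<in> K; b \<in> carrier G\<rbrakk> \<Longrightarrow> k \<otimes> (k \<otimes> b) = b"
  using cancel_left(1)[of k b] by simp

lemma K_not_one:
  assumes "k \<in> K"
  shows "k \<noteq> \<one>"
proof
  assume k: "k = \<one>"
  obtain h where h: "h \<in> carrier G" "k = h \<otimes> x \<otimes> inv h"
    using assms K_cases by metis
  then have "x = inv h \<otimes> k \<otimes> h"
    by (simp add: m_assoc)
  then show False
    using h(1) k x_not_one by simp
qed

lemma K_centralizer_trivial:
  assumes "k \<in> K" "g \<in> carrier G" "g \<otimes> k = k \<otimes> g"
  shows "g = \<one> \<or> g = k"
proof -
  obtain h where h: "h \<in> carrier G" "k = h \<otimes> x \<otimes> inv h"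
    using assms K_cases by metis
  define c where "c = inv h \<otimes> g \<otimes> h"
  have c: "c \<in> carrier G"
    using assms h by (simp add: c_def)
  have "c \<otimes> x = inv h \<otimes> (g \<otimes> k) \<otimes> h"
    using assms(2) h by (simp add: c_def m_assoc)
  also have "\<dots> = inv h \<otimes> (k \<otimes> g) \<otimes> h"
    using assms(3) by simp
  also have "\<dots> = x \<otimes> c"
    using assms(2) h by (simp add: c_def m_assoc)
  finally have "c = \<one> \<or> c = x"
    using centralizer_trivial c by blast
  moreover have "g = h \<otimes> c \<otimes> inv h"
    using assms(2) h by (simp add: c_def m_assoc)
  ultimately show ?thesis
    using h by auto
qed

text \<open>
  The fibres of \<open>g \<mapsto> g x g\<inverse>\<close> are the left cosets of the centralizer \<open>{\<one>, x}\<close>.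
\<close>

lemma order_eq_double_card_K: "order G = 2 * card K"
proof -
  have fibre: "card {h \<in> carrier G. h \<otimes> x \<otimes> inv h = k} = 2" if k: "k \<in> K" for k
  proof -
    obtain g where g: "g \<in> carrier G" "k = g \<otimes> x \<otimes> inv g"
      using k K_cases by metis
    have "h = g \<or> h = g \<otimes> x" if h: "h \<in> carrier G" "h \<otimes> x \<otimes> inv h = k" for h
    proof -
      have "(inv g \<otimes> h) \<otimes> x = inv g \<otimes> (h \<otimes> x \<otimes> inv h) \<otimes> h"
        using g h(1) by (simp add: m_assoc)
      also have "\<dots> = x \<otimes> (inv g \<otimes> h)"
        using g h by (simp add: m_assoc)
      finally have "inv g \<otimes> h = \<one> \<or> inv g \<otimes> h = x"
        using centralizer_trivial g h by simp
      moreover have "h = g \<otimes> (inv g \<otimes> h)"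
        using g h by simp
      ultimately show ?thesis
        using g by auto
    qed
    moreover have "(g \<otimes> x) \<otimes> x \<otimes> inv (g \<otimes> x) = k"
    proof -
      have "inv x = x"
        using x_in_K by simp
      then show ?thesis
        using g by (simp add: m_assoc inv_mult_group)
    qed
    ultimately have "{h \<in> carrier G. h \<otimes> x \<otimes> inv h = k} = {g, g \<otimes> x}"
      using g by auto
    moreover have "g \<otimes> x \<noteq> g"
      using g(1) x_not_one by simp
    ultimately show ?thesis
      by simp
  qed
  have "order G = (\<Sum>h \<in> carrier G. 1)"
    by (simp add: order_def)
  also have "\<dots> = (\<Sum>k \<in> K. \<Sum>h \<in> {h \<in> carrier G. h \<otimes> x \<otimes> inv h = k}. 1)"
    unfolding K_def by (rule sum.image_gen[OF finite_carrier])
  also have "\<dots> = 2 * card K"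
    using fibre by simp
  finally show ?thesis .
qed

text \<open>
  If \<open>k l\<close> were an involution, then \<open>k\<close> and \<open>l\<close> would commute, hence be equal, and \<open>k l\<close> would be \<open>\<one>\<close>.
\<close>

lemma K_mult_notin_K:
  assumes k: "k \<in> K" and l: "l \<in> K"
  shows "k \<otimes> l \<notin> K"
proof
  assume kl: "k \<otimes> l \<in> K"
  have "l \<otimes> k = inv (k \<otimes> l)"
    using k l by (simp add: inv_mult_group del: K_inv add: K_inv[OF k] K_inv[OF l])
  also have "\<dots> = k \<otimes> l"
    by (rule K_inv[OF kl])
  finally have "l = k"
    using K_centralizer_trivial[of k l] k l K_not_one by auto
  then show False
    using kl k K_not_one[OF kl] by simp
qed

lemma mult_K_eq_complement:
  assumes k: "k \<in> K"
  shows "(\<lambda>l. k \<otimes> l) ` K = carrier G - K"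
proof (rule card_subset_eq)
  show "finite (carrier G - K)"
    using finite_carrier by simp
  show "(\<lambda>l. k \<otimes> l) ` K \<subseteq> carrier G - K"
    using k K_mult_notin_K by auto
  have "inj_on (\<lambda>l. k \<otimes> l) K"
    using k by (intro inj_onI) simp
  then have "card ((\<lambda>l. k \<otimes> l) ` K) = card K"
    by (rule card_image)
  also have "\<dots> = card (carrier G - K)"
    using order_eq_double_card_K card_Diff_subset[OF finite_K, of "carrier G"] K_closed
    by (simp add: order_def subset_iff)
  finally show "card ((\<lambda>l. k \<otimes> l) ` K) = card (carrier G - K)" .
qed

lemma K_inverts_complement:
  assumes k: "k \<in> K" and a: "a \<in> carrier G - K"
  shows "k \<otimes> a = inv a \<otimes> k"
proof -
  obtain l where l: "l \<in> K" "a = k \<otimes> l"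
    using mult_K_eq_complement[OF k] a by auto
  then show ?thesis
    using k by (simp add: inv_mult_group m_assoc)
qed

lemma complement_commute:
  assumes a: "a \<in> carrier G - K" and b: "b \<in> carrier G - K"
  shows "a \<otimes> b = b \<otimes> a"
proof -
  obtain l where l: "l \<in> K" "b = x \<otimes> l"
    using mult_K_eq_complement[OF x_in_K] b by auto
  have "a \<otimes> x = a \<otimes> (x \<otimes> a) \<otimes> inv a"
    using a by (simp add: m_assoc)
  also have "\<dots> = x \<otimes> inv a"
    using K_inverts_complement[OF x_in_K a] a by simp
  finally have xa: "a \<otimes> x = x \<otimes> inv a" .
  have "a \<otimes> b = (a \<otimes> x) \<otimes> l"
    using a l by (simp add: m_assoc)
  also have "\<dots> = x \<otimes> (inv a \<otimes> l)"
    using xa a l by (simp add: m_assoc)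
  also have "\<dots> = x \<otimes> (l \<otimes> a)"
    using K_inverts_complement[OF l(1) a] by simp
  also have "\<dots> = b \<otimes> a"
    using a l by (simp add: m_assoc)
  finally show ?thesis .
qed

lemma exists_other_in_K:
  assumes "\<not> comm_group G"
  obtains k where "k \<in> K" "k \<noteq> x"
proof -
  have "\<not> K \<subseteq> {x}"
  proof
    assume "K \<subseteq> {x}"
    then have K: "K = {x}"
      using x_in_K by blast
    \<comment> \<open>Then \<open>x\<close> is central, so that \<open>G\<close> is its centralizer \<open>{\<one>, x}\<close>.\<close>
    have G: "g = \<one> \<or> g = x" if g: "g \<in> carrier G" for g
    proof (rule centralizer_trivial[OF g])
      have "g \<otimes> x \<otimes> inv g = x"
        using K_conj_closed[OF g x_in_K] K by simp
      then show "g \<otimes> x = x \<otimes> g"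
        using g by (metis inv_solve_right m_closed x_closed)
    qed
    have "comm_group G"
      by (rule group_comm_groupI) (use G in \<open>metis l_one r_one x_closed\<close>)
    then show False
      using assms by contradiction
  qed
  then show thesis
    using that by blast
qed

lemma card_K_ge_3:
  assumes "\<not> comm_group G"
  shows "3 \<le> card K"
proof -
  obtain k where k: "k \<in> K" "k \<noteq> x"
    using exists_other_in_K[OF assms] .
  define j where "j = x \<otimes> k \<otimes> x"
  have j: "j \<in> K"
    using K_conj_closed[of x k] k x_in_K by (simp add: j_def)
  have xj: "x \<otimes> j = k \<otimes> x"
    using k x_in_K by (simp add: j_def m_assoc)
  have "j \<noteq> x"
  proof
    assume "j = x"
    then have "inv x = k"
      using xj k by (intro inv_equality) simp_all
    then show False
      using k x_in_K by simp
  qed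
  moreover have "j \<noteq> k"
    using xj centralizer_trivial[of k] k K_not_one by auto
  ultimately have "card {x, k, j} = 3"
    using k by auto
  moreover have "{x, k, j} \<subseteq> K"
    using x_in_K k j by simp
  ultimately show ?thesis
    using card_mono[OF finite_K] by metis
qed

text \<open>
  The vertices in \<open>K\<close> are isolated and must all be chosen; one further vertex \<open>a\<close> is necessary and
  sufficient for the clique outside \<open>K\<close>.
\<close>

lemma domination_number_eq:
  assumes nc: "\<not> comm_group G"
  shows "domination_number (proper_commuting_graph G) = card K + 1"
proof -
  let ?H = "proper_commuting_graph G"
  obtain k where k: "k \<in> K" "k \<noteq> x"
    using exists_other_in_K[OF nc] .
  define a where "a = x \<otimes> k"
  have a: "a \<in> carrier G - K"
    using k x_in_K K_mult_notin_K by (simp add: a_def)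
  have a1: "a \<noteq> \<one>"
  proof
    assume "a = \<one>"
    then have "inv k = x"
      using k by (intro inv_equality) (auto simp: a_def)
    then show False
      using k by simp
  qed
  have noncentral: "g \<notin> center G" if g: "g \<in> carrier G" "g \<noteq> \<one>" for g
  proof
    assume "g \<in> center G"
    then have "g \<otimes> x = x \<otimes> g" "g \<otimes> k = k \<otimes> g"
      using k by (auto simp: center_def)
    then show False
      using centralizer_trivial[of g] K_centralizer_trivial[of k g] g k by auto
  qed
  have one: "\<one> \<in> center G"
    by (auto simp: center_def)
  have "dominating_set ?H (insert a K)"
    unfolding dominating_set_def
  proof (intro conjI ballI)
    show "insert a K \<subseteq> pverts ?H"
      using a a1 noncentral K_not_one by (auto simp: proper_commuting_graph_def)
  next
    fix v assume v: "v \<in> pverts ?H - insert a K"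
    then have "(v, a) \<in> parcs ?H"
      using a a1 noncentral complement_commute[of v a]
      by (auto simp: proper_commuting_graph_def)
    then show "\<exists>y \<in> insert a K. (v, y) \<in> parcs ?H"
      by blast
  qed
  then have "domination_number ?H \<le> card (insert a K)"
    by (rule domination_number_le)
  then have upper: "domination_number ?H \<le> card K + 1"
    using a finite_K by simp
  obtain X where X: "dominating_set ?H X" and cX: "card X = domination_number ?H"
    by (rule domination_number_attained)
  have isolated: "(l, y) \<notin> parcs ?H" "(y, l) \<notin> parcs ?H" if l: "l \<in> K" for l y
    using K_centralizer_trivial[OF l, of y] one
    by (auto simp: proper_commuting_graph_def)
  have "K \<subseteq> X"
  proof
    fix l assume l: "l \<in> K"
    then have "l \<in> pverts ?H"
      using noncentral K_not_one by (simp add: proper_commuting_graph_def)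
    then show "l \<in> X"
      using X isolated(1)[OF l] unfolding dominating_set_def by blast
  qed
  moreover have "\<exists>y \<in> X. y \<notin> K"
  proof (cases "a \<in> X")
    case True
    then show ?thesis
      using a by blast
  next
    case False
    have "a \<in> pverts ?H"
      using a a1 noncentral by (simp add: proper_commuting_graph_def)
    then obtain y where "y \<in> X" "(a, y) \<in> parcs ?H"
      using False X by (auto simp: dominating_set_def)
    then show ?thesis
      using isolated by blast
  qed
  moreover have "finite X"
    using X finite_carrier
    by (auto simp: dominating_set_def proper_commuting_graph_def intro: finite_subset)
  ultimately have "card K < card X"
    by (intro psubset_card_mono) auto
  then show ?thesis
    using upper cX by simp
qed

text \<open>
  The action of \<open>G\<close> on \<open>K\<close> by conjugation is faithful, because \<open>x\<close> and some other element of \<open>K\<close>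
  have centralizers that meet trivially. For \<open>\<bar>K\<bar> = 3\<close> it has to be all of \<open>S\<^sub>3\<close> by order.
\<close>

lemma iso_sym_group_3:
  assumes nc: "\<not> comm_group G" and card_K: "card K = 3"
  shows "G \<cong> sym_group 3"
proof -
  obtain f :: "nat \<Rightarrow> 'a" where f: "bij_betw f {1..3} K"
    using ex_bij_betw_nat_finite_1[OF finite_K] card_K by auto
  have fK: "f i \<in> K" if "i \<in> {1..3}" for i
    using f that by (meson bij_betwE)
  define \<phi> where "\<phi> g i =
    (if i \<in> {1..3} then inv_into {1..3} f (g \<otimes> f i \<otimes> inv g) else i)" for g and i :: nat
  have \<phi>_in: "\<phi> g i \<in> {1..3}" and f\<phi>: "f (\<phi> g i) = g \<otimes> f i \<otimes> inv g"
    if g: "g \<in> carrier G" and i: "i \<in> {1..3}" for g i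
  proof -
    have "g \<otimes> f i \<otimes> inv g \<in> f ` {1..3}"
      using K_conj_closed[OF g fK[OF i]] f by (simp add: bij_betw_def)
    then show "\<phi> g i \<in> {1..3}" "f (\<phi> g i) = g \<otimes> f i \<otimes> inv g"
      using i inv_into_into[of _ f "{1..3}"] f_inv_into_f[of _ f "{1..3}"]
      by (simp_all add: \<phi>_def)
  qed
  have f_inj: "i = j" if "f i = f j" "i \<in> {1..3}" "j \<in> {1..3}" for i j
    using f that by (auto simp: bij_betw_def dest: inj_onD)
  have \<phi>_permutes: "\<phi> g permutes {1..3}" if g: "g \<in> carrier G" for g
  proof (rule bij_imp_permutes)
    have "inj_on (\<phi> g) {1..3}"
    proof (rule inj_onI)
      fix i j assume ij: "i \<in> {1..3}" "j \<in> {1..3}" "\<phi> g i = \<phi> g j"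
      then have "g \<otimes> f i \<otimes> inv g = g \<otimes> f j \<otimes> inv g"
        using f\<phi>[OF g] by metis
      then have "f i = f j"
        using g fK ij by simp
      then show "i = j"
        using f_inj ij by blast
    qed
    moreover have "\<phi> g ` {1..3} \<subseteq> {1..3}"
      using \<phi>_in[OF g] by blast
    ultimately show "bij_betw (\<phi> g) {1..3} {1..3}"
      unfolding bij_betw_def using endo_inj_surj[of "{1..3}" "\<phi> g"] by simp
  qed (simp add: \<phi>_def del: atLeastAtMost_iff)
  have \<phi>_mult: "\<phi> (g \<otimes> h) = \<phi> g \<circ> \<phi> h" if g: "g \<in> carrier G" and h: "h \<in> carrier G" for g h
  proof
    fix i
    show "\<phi> (g \<otimes> h) i = (\<phi> g \<circ> \<phi> h) i"
    proof (cases "i \<in> {1..3}")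
      case True
      have "f (\<phi> (g \<otimes> h) i) = f (\<phi> g (\<phi> h i))"
        using g h True fK[OF True] \<phi>_in[OF h True] f\<phi>
        by (simp add: m_assoc inv_mult_group del: atLeastAtMost_iff)
      then show ?thesis
        using f_inj \<phi>_in g h True by (simp del: atLeastAtMost_iff)
    next
      case False
      then show ?thesis
        by (simp add: \<phi>_def del: atLeastAtMost_iff)
    qed
  qed
  have hom: "\<phi> \<in> hom G (sym_group 3)"
    using \<phi>_permutes \<phi>_mult by (auto intro!: homI simp: sym_group_carrier sym_group_mult)
  obtain k where k: "k \<in> K" "k \<noteq> x"
    using exists_other_in_K[OF nc] .
  have inj: "inj_on \<phi> (carrier G)"
  proof (rule inj_onI)
    fix g h assume g: "g \<in> carrier G" and h: "h \<in> carrier G" and eq: "\<phi> g = \<phi> h"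
    have fixes_K: "(inv h \<otimes> g) \<otimes> l = l \<otimes> (inv h \<otimes> g)" if l: "l \<in> K" for l
    proof -
      obtain i where i: "i \<in> {1..3}" "l = f i"
        using f l by (metis bij_betw_imp_surj_on imageE)
      then have conj_eq: "g \<otimes> l \<otimes> inv g = h \<otimes> l \<otimes> inv h"
        using f\<phi>[OF g i(1)] f\<phi>[OF h i(1)] eq by simp
      have "(inv h \<otimes> g) \<otimes> l = inv h \<otimes> (g \<otimes> l \<otimes> inv g) \<otimes> g"
        using g h l by (simp add: m_assoc)
      also have "\<dots> = l \<otimes> (inv h \<otimes> g)"
        using g h l by (simp add: conj_eq m_assoc)
      finally show ?thesis .
    qed
    have "inv h \<otimes> g = \<one>"
      using fixes_K[OF x_in_K] fixes_K[OF k(1)] K_centralizer_trivial[of k "inv h \<otimes> g"]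
        centralizer_trivial[of "inv h \<otimes> g"] g h k by auto
    moreover have "g = h \<otimes> (inv h \<otimes> g)"
      using g h by simp
    ultimately show "g = h"
      using h by simp
  qed
  have "card (carrier (sym_group 3)) = 6"
    by (simp add: sym_group_card_carrier fact_numeral)
  moreover have "card (carrier G) = 6"
    using order_eq_double_card_K card_K by (simp add: order_def)
  moreover have "\<phi> ` carrier G \<subseteq> carrier (sym_group 3)"
    using \<phi>_permutes by (auto simp: sym_group_carrier)
  ultimately have "\<phi> ` carrier G = carrier (sym_group 3)"
    using card_image[OF inj] by (intro card_subset_eq) (auto intro: card_ge_0_finite)
  then show ?thesis
    using hom inj by (intro is_isoI[of \<phi>]) (simp add: iso_iff)
qed

lemma domination_ratio:
  assumes nc: "\<not> comm_group G"
  shows "real (domination_number (proper_commuting_graph G)) / real (order G) \<le> 2 / 3"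
    and "real (domination_number (proper_commuting_graph G)) / real (order G) = 2 / 3
      \<longleftrightarrow> G \<cong> sym_group 3"
proof -
  let ?q = "real (domination_number (proper_commuting_graph G)) / real (order G)"
  have K3: "3 \<le> card K"
    by (rule card_K_ge_3[OF nc])
  have q: "?q = (real (card K) + 1) / (2 * real (card K))"
    using domination_number_eq[OF nc] order_eq_double_card_K by simp
  show "?q \<le> 2 / 3"
    unfolding q using K3 by (simp add: divide_simps)
  have "?q = 2 / 3 \<longleftrightarrow> card K = 3"
    unfolding q using K3 by (auto simp: divide_simps)
  also have "\<dots> \<longleftrightarrow> G \<cong> sym_group 3"
  proof
    assume "G \<cong> sym_group 3"
    then have "order G = 6"
      using iso_same_card by (fastforce simp: order_def sym_group_card_carrier fact_numeral)
    then show "card K = 3"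
      using order_eq_double_card_K by simp
  qed (rule iso_sym_group_3[OF nc])
  finally show "?q = 2 / 3 \<longleftrightarrow> G \<cong> sym_group 3" .
qed

end

section \<open>Isolated vertices of the commuting graph\<close>

text \<open>
  An isolated vertex \<open>x\<close> commutes with \<open>x z\<close> for each central \<open>z\<close>, and \<open>x z\<close> is not central, so
  \<open>x z = x\<close>. Hence the center is trivial, and the centralizer of \<open>x\<close> has no room for anything but
  \<open>\<one>\<close> and \<open>x\<close>.
\<close>

lemma isolated_vertex_self_centralizing:
  assumes "group G" "finite (carrier G)" and x: "x \<in> carrier G - center G"
    and isolated: "\<And>y. (x, y) \<notin> parcs (proper_commuting_graph G)"
  shows "self_centralizing_involution G x"
proof -
  interpret group G by fact
  have cent: "g \<in> center G \<or> g = x"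
    if "g \<in> carrier G" "g \<otimes>\<^bsub>G\<^esub> x = x \<otimes>\<^bsub>G\<^esub> g" for g
    using isolated[of g] x that by (auto simp: proper_commuting_graph_def)
  have one: "\<one>\<^bsub>G\<^esub> \<in> center G"
    by (auto simp: center_def)
  have xG: "x \<in> carrier G"
    using x by simp
  have center_trivial: "z = \<one>\<^bsub>G\<^esub>" if z: "z \<in> center G" for z
  proof -
    have zG: "z \<in> carrier G" and comm: "\<And>g. g \<in> carrier G \<Longrightarrow> z \<otimes>\<^bsub>G\<^esub> g = g \<otimes>\<^bsub>G\<^esub> z"
      using z by (auto simp: center_def)
    have "x \<otimes>\<^bsub>G\<^esub> z \<notin> center G"
    proof
      assume xz: "x \<otimes>\<^bsub>G\<^esub> z \<in> center G"
      have "x \<otimes>\<^bsub>G\<^esub> g = g \<otimes>\<^bsub>G\<^esub> x" if g: "g \<in> carrier G" for g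
      proof -
        have "(x \<otimes>\<^bsub>G\<^esub> z) \<otimes>\<^bsub>G\<^esub> g = g \<otimes>\<^bsub>G\<^esub> (x \<otimes>\<^bsub>G\<^esub> z)"
          using xz g by (simp add: center_def)
        then have "(x \<otimes>\<^bsub>G\<^esub> g) \<otimes>\<^bsub>G\<^esub> z = (g \<otimes>\<^bsub>G\<^esub> x) \<otimes>\<^bsub>G\<^esub> z"
          using comm[OF g] g xG zG by (simp add: m_assoc)
        then show ?thesis
          using g xG zG by simp
      qed
      then show False
        using x by (simp add: center_def)
    qed
    moreover have "(x \<otimes>\<^bsub>G\<^esub> z) \<otimes>\<^bsub>G\<^esub> x = x \<otimes>\<^bsub>G\<^esub> (x \<otimes>\<^bsub>G\<^esub> z)"
      using comm[OF xG] xG zG by (simp add: m_assoc)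
    ultimately have "x \<otimes>\<^bsub>G\<^esub> z = x"
      using cent[of "x \<otimes>\<^bsub>G\<^esub> z"] xG zG by auto
    then show ?thesis
      using xG zG by simp
  qed
  show ?thesis
  proof unfold_locales
    show "finite (carrier G)" by fact
    show "x \<in> carrier G" by (rule xG)
    show "x \<noteq> \<one>\<^bsub>G\<^esub>"
      using x one by blast
    show "g = \<one>\<^bsub>G\<^esub> \<or> g = x" if "g \<in> carrier G" "g \<otimes>\<^bsub>G\<^esub> x = x \<otimes>\<^bsub>G\<^esub> g" for g
      using cent[OF that] center_trivial by blast
  qed
qed

lemma exists_self_centralizing_if_iso_sym_group_3:
  assumes "group G" "finite (carrier G)" and iso: "G \<cong> sym_group 3"
  shows "\<exists>x. self_centralizing_involution G x"
proof -
  interpret group G by fact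
  let ?S = "sym_group 3"
  let ?t = "Transposition.transpose 1 2 :: nat \<Rightarrow> nat"
  obtain h where h: "h \<in> iso G ?S"
    using iso by (auto simp: is_iso_def)
  then have hom: "h \<in> hom G ?S" and img: "h ` carrier G = carrier ?S" and inj: "inj_on h (carrier G)"
    by (auto simp: iso_iff)
  have "?t permutes {1..3}"
    by (rule permutes_swap_id) auto
  then obtain x where x: "x \<in> carrier G" "h x = ?t"
    using img by (metis imageE sym_group_carrier)
  have h1: "h \<one>\<^bsub>G\<^esub> = id"
    using hom_one[OF hom is_group sym_group_is_group] by (simp add: sym_group_one)
  have t: "?t \<noteq> id"
    by (simp add: transpose_eq_id_iff)
  have "g = \<one>\<^bsub>G\<^esub> \<or> g = x" if g: "g \<in> carrier G" and comm: "g \<otimes>\<^bsub>G\<^esub> x = x \<otimes>\<^bsub>G\<^esub> g" for g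
  proof -
    have "h g \<in> carrier ?S"
      using img g by blast
    then have p: "h g permutes {1..3}"
      by (simp add: sym_group_carrier)
    have "h g \<circ> ?t = ?t \<circ> h g"
      using hom_mult[OF hom g x(1)] hom_mult[OF hom x(1) g] comm x(2) by (simp add: sym_group_mult)
    then have pt: "h g (?t i) = ?t (h g i)" for i
      by (metis comp_apply)
    have mem: "h g i = 1 \<or> h g i = 2 \<or> h g i = 3" if "i = 1 \<or> i = 2 \<or> i = 3" for i
    proof -
      have "h g i \<in> {1..3}"
        using permutes_in_image[OF p, of i] that by auto
      then show ?thesis
        by auto
    qed
    have outside: "h g i = i" if "i \<noteq> 1" "i \<noteq> 2" "i \<noteq> 3" for i
      using p that by (intro permutes_not_in[OF p]) auto
    \<comment> \<open>A permutation that commutes with \<open>(1 2)\<close> preserves its only fixed point \<open>3\<close> among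
      \<open>1, 2, 3\<close>.\<close>
    have p3: "h g 3 = 3"
      using pt[of 3] mem[of 3] by auto
    have inj_p: "h g i = h g j \<longleftrightarrow> i = j" for i j
      using permutes_inj[OF p] by (rule inj_eq)
    have p12: "h g 1 \<noteq> 3" "h g 2 \<noteq> 3" "h g 1 \<noteq> h g 2"
      using inj_p[of 1 3] inj_p[of 2 3] inj_p[of 1 2] p3 by simp_all
    have "h g = id \<or> h g = ?t"
    proof (cases "h g 1 = 1")
      case True
      then have "h g i = i" for i
        using p3 p12 mem[of 2] outside[of i] by (cases "i = 1 \<or> i = 2 \<or> i = 3") auto
      then show ?thesis
        by auto
    next
      case False
      then have "h g i = ?t i" for i
        using p3 p12 mem[of 1] mem[of 2] outside[of i]
        by (cases "i = 1 \<or> i = 2 \<or> i = 3") auto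
      then show ?thesis
        by blast
    qed
    then show ?thesis
      using inj g x h1 by (metis inj_onD one_closed)
  qed
  then have "self_centralizing_involution G x"
    by unfold_locales (use assms(2) x h1 t in auto)
  then show ?thesis ..
qed

lemma domination_ratio_if_no_isolated_vertex:
  assumes "group G" "finite (carrier G)"
    and no_isolated: "\<And>x. \<not> self_centralizing_involution G x"
  shows "real (domination_number (proper_commuting_graph G)) / real (order G) < 1 / 2"
proof -
  interpret group G by fact
  let ?H = "proper_commuting_graph G"
  have "2 * domination_number ?H \<le> card (pverts ?H)"
  proof (rule domination_number_le_half)
    show "finite (pverts ?H)"
      using assms(2) by (simp add: proper_commuting_graph_def)
    show "(v, u) \<in> parcs ?H" if "(u, v) \<in> parcs ?H" for u v
      using that by (auto simp: proper_commuting_graph_def)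
    show "\<exists>w \<in> pverts ?H. w \<noteq> v \<and> (v, w) \<in> parcs ?H" if "v \<in> pverts ?H" for v
    proof -
      have "v \<in> carrier G - center G"
        using that by (simp add: proper_commuting_graph_def)
      then obtain w where "(v, w) \<in> parcs ?H"
        using isolated_vertex_self_centralizing[OF assms(1,2)] no_isolated by metis
      then show ?thesis
        by (auto simp: proper_commuting_graph_def)
    qed
  qed
  also have "card (pverts ?H) < order G"
    unfolding order_def
  proof (rule psubset_card_mono[OF assms(2)])
    have "\<one>\<^bsub>G\<^esub> \<in> center G"
      by (auto simp: center_def)
    then show "pverts ?H \<subset> carrier G"
      by (auto simp: proper_commuting_graph_def)
  qed
  finally show ?thesis
    by (simp add: divide_simps)
qed

theorem theorem7p1:
  fixes G :: "('a, 'b) monoid_scheme"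
  assumes "group G" and "finite (carrier G)" and "\<not> comm_group G"
  shows "real (domination_number (proper_commuting_graph G)) / real (order G) \<le> 2 / 3 \<and>
         (real (domination_number (proper_commuting_graph G)) / real (order G) = 2 / 3
            \<longleftrightarrow> G \<cong> sym_group 3)"
proof (cases "\<exists>x. self_centralizing_involution G x")
  case True
  then obtain x where "self_centralizing_involution G x" ..
  then interpret self_centralizing_involution G x .
  show ?thesis
    using domination_ratio[OF assms(3)] by simp
next
  case False
  then have "\<not> G \<cong> sym_group 3"
    using exists_self_centralizing_if_iso_sym_group_3 assms(1,2) by blast
  then show ?thesis
    using domination_ratio_if_no_isolated_vertex[OF assms(1,2)] False by fastforce
qed

end
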